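(* Let $A$ be a finite-dimensional anti-commutative CB-algebra over any field $F$. (a) If $F$ has characteristic different from two, then $A^4=0$. (b) Moreover, $A$ is metabelian, that is, $A^{(2)}=0$. (c) If $A$ is a Lie algebra and $F$ has characteristic different from three, then $A^3=0$. (d) If $A$ is an associative algebra and $F$ has characteristic different from two, then $A^3=0$.
   Context: An algebra over $F$ is a vector space with a bilinear product (not assumed associative), written by juxtaposition. It is anti-commutative if $x^2=0$ for all $x\in A$. An anti-commutative algebra $A$ is a CB-algebra if, whenever $x,y\in A$ satisfy $xy=0$, then $(xz)y=0$ for all $z\in A$. Put $A^2=\mathrm{span}\{xy\mid x,y\in A\}$ and $A^k=A^{k-1}A$ (span of products) for $k\ge 3$. Put $A^{(0)}=A$ and $A^{(k)}=A^{(k-1)}A^{(k-1)}$ (span of products) for $k\ge 1$.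
   Formalization: Part (b) is stated only for F of characteristic different from two, as in (a); in characteristic two it fails, e.g. for the positive-degree part of the exterior algebra of F^4, where (e1e2)(e3e4) is nonzero. *)

theory Defs
  imports Complex_Main
begin

text \<open>
  The carrier of the algebra is the whole type \<open>'a\<close>; the product is neither assumed associative
  nor unital.
\<close>

locale nonassoc_algebra = vector_space scale
  for scale :: "'f::field \<Rightarrow> 'a::ab_group_add \<Rightarrow> 'a" (infixr \<open>*s\<close> 75) +
  fixes mult :: "'a \<Rightarrow> 'a \<Rightarrow> 'a" (infixl \<open>\<bullet>\<close> 70)
  assumes linear_left: "Vector_Spaces.linear scale scale (\<lambda>x. x \<bullet> y)"
    and linear_right: "Vector_Spaces.linear scale scale (\<lambda>y. x \<bullet> y)"
begin

definition span_prod :: "'a set \<Rightarrow> 'a set \<Rightarrow> 'a set" where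
  "span_prod U V = span {u \<bullet> v | u v. u \<in> U \<and> v \<in> V}"

text \<open>
  Exponents \<open>k \<ge> 2\<close> give \<open>A\<^sup>k = A\<^sup>k\<^sup>-\<^sup>1 A\<close>, starting from \<open>A\<^sup>1 = A\<close>; exponent \<open>0\<close> has no meaning
  (there is no unit) and is set to \<open>A\<close> only to make the function total.
\<close>

fun alg_power :: "nat \<Rightarrow> 'a set" where
  "alg_power 0 = UNIV"
| "alg_power (Suc 0) = UNIV"
| "alg_power (Suc (Suc k)) = span_prod (alg_power (Suc k)) UNIV"

primrec derived_power :: "nat \<Rightarrow> 'a set" where
  "derived_power 0 = UNIV"
| "derived_power (Suc k) = span_prod (derived_power k) (derived_power k)"

definition metabelian :: bool where
  "metabelian \<longleftrightarrow> derived_power 2 = {0}"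

end

locale anticommutative_algebra = nonassoc_algebra +
  assumes square_zero: "x \<bullet> x = 0"

locale cb_algebra = anticommutative_algebra +
  assumes cb: "x \<bullet> y = 0 \<Longrightarrow> (x \<bullet> z) \<bullet> y = 0"

locale lie_algebra = anticommutative_algebra +
  assumes jacobi: "(x \<bullet> y) \<bullet> z + (y \<bullet> z) \<bullet> x + (z \<bullet> x) \<bullet> y = 0"

locale assoc_algebra = nonassoc_algebra +
  assumes assoc: "(x \<bullet> y) \<bullet> z = x \<bullet> (y \<bullet> z)"

end

theory Submission
  imports Defs "HOL-Computational_Algebra.Primes"
begin

text \<open>
  The CB condition with \<open>y = x\<close> gives \<open>(x z) x = 0\<close>, and linearizing this makes the triple product
  \<open>(x y) z\<close> alternating. The Jacobi identity then reads \<open>3 (x y) z = 0\<close>, and associativity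
  \<open>2 (x y) z = 0\<close>. Applying the alternating property twice, \<open>((x y) z) w = (z w) (x y)\<close> is alternating
  in all four arguments; exchanging the pairs \<open>(x, y)\<close> and \<open>(z, w)\<close> is an even permutation, yet
  it changes the sign of \<open>(z w) (x y)\<close>.
\<close>

text \<open>If \<open>p\<close> were zero, the characteristic would be a divisor of \<open>p\<close>
  other than \<open>p\<close>, hence 1, which would force 1 = 0.\<close>

lemma CHAR_neq_prime_imp_of_nat_neq_0:
  assumes "prime p" and "CHAR('a::semidom) \<noteq> p"
  shows "(of_nat p :: 'a) \<noteq> 0"
proof
  assume "(of_nat p :: 'a) = 0"
  then have "CHAR('a) dvd p"
    by (simp add: of_nat_eq_0_iff_char_dvd)
  then have "CHAR('a) = 1"
    using assms by (auto simp: prime_nat_iff)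
  then show False
    by (metis of_nat_CHAR of_nat_1 zero_neq_one)
qed

context vector_space
begin

lemma double_eq_0_imp:
  fixes x :: 'b
  assumes "x + x = 0" and "CHAR('a) \<noteq> 2"
  shows "x = 0"
proof -
  have "of_nat 2 *s x = x + x"
    by (simp only: numeral_2_eq_2 of_nat_Suc of_nat_0 scale_left_distrib scale_one scale_zero_left add_0_right)
  then show ?thesis
    using assms CHAR_neq_prime_imp_of_nat_neq_0[OF two_is_prime_nat] by (metis scale_eq_0_iff)
qed

lemma triple_eq_0_imp:
  fixes x :: 'b
  assumes "x + x + x = 0" and "CHAR('a) \<noteq> 3"
  shows "x = 0"
proof -
  have "of_nat 3 *s x = x + x + x"
    by (simp only: numeral_3_eq_3 of_nat_Suc of_nat_0 scale_left_distrib scale_one scale_zero_left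
        add_0_right add.assoc)
  moreover have "(of_nat 3 :: 'a) \<noteq> 0"
    using assms(2) by (intro CHAR_neq_prime_imp_of_nat_neq_0) simp_all
  ultimately show ?thesis
    using assms(1) by (metis scale_eq_0_iff)
qed

end

context nonassoc_algebra
begin

lemma mult_add_left: "(x + y) \<bullet> z = x \<bullet> z + y \<bullet> z"
  by (rule module_hom.add[OF linear_left[THEN Vector_Spaces.linear.axioms(3)]])

lemma mult_add_right: "x \<bullet> (y + z) = x \<bullet> y + x \<bullet> z"
  by (rule module_hom.add[OF linear_right[THEN Vector_Spaces.linear.axioms(3)]])

lemma mult_minus_left: "(- x) \<bullet> y = - (x \<bullet> y)"
  by (rule module_hom.neg[OF linear_left[THEN Vector_Spaces.linear.axioms(3)]])

lemma span_prod_eq_0_iff: "span_prod U V = {0} \<longleftrightarrow> (\<forall>u\<in>U. \<forall>v\<in>V. u \<bullet> v = 0)"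
proof
  assume zero: "span_prod U V = {0}"
  show "\<forall>u\<in>U. \<forall>v\<in>V. u \<bullet> v = 0"
  proof (intro ballI)
    fix u v assume "u \<in> U" "v \<in> V"
    then have "u \<bullet> v \<in> span_prod U V"
      unfolding span_prod_def by (intro span_base) blast
    then show "u \<bullet> v = 0"
      by (simp add: zero)
  qed
next
  assume "\<forall>u\<in>U. \<forall>v\<in>V. u \<bullet> v = 0"
  then have "span_prod U V \<subseteq> span {0}"
    unfolding span_prod_def by (intro span_mono) auto
  then show "span_prod U V = {0}"
    unfolding span_prod_def using span_zero by auto
qed

text \<open>The kernel of \<open>f\<close> is a subspace, so it contains the span as soon as it
  contains the generating products. This reduces all claims on spans to identities between
  elements.\<close>

lemma span_prod_induct [consumes 1, case_names prod linear]:
  assumes "a \<in> span_prod U V"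
    and "\<And>u v. u \<in> U \<Longrightarrow> v \<in> V \<Longrightarrow> f (u \<bullet> v) = 0"
    and "Vector_Spaces.linear scale scale f"
  shows "f a = 0"
proof -
  interpret f: Vector_Spaces.linear scale scale f by fact
  show ?thesis
    using assms(1) unfolding span_prod_def
  proof (rule f.eq_0_on_span[rotated])
    fix b assume "b \<in> {u \<bullet> v |u v. u \<in> U \<and> v \<in> V}"
    then show "f b = 0"
      using assms(2) by blast
  qed
qed

lemma alg_power_3: "alg_power 3 = span_prod (span_prod UNIV UNIV) UNIV"
  by (simp add: numeral_3_eq_3)

lemma alg_power_4: "alg_power 4 = span_prod (span_prod (span_prod UNIV UNIV) UNIV) UNIV"
  by (simp add: eval_nat_numeral)

lemma alg_power_3_eq_0I:
  assumes "\<And>x y z. (x \<bullet> y) \<bullet> z = 0"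
  shows "alg_power 3 = {0}"
  unfolding alg_power_3 span_prod_eq_0_iff
proof (intro ballI)
  fix a z assume "a \<in> span_prod UNIV UNIV"
  then show "a \<bullet> z = 0"
    using assms linear_left by (rule span_prod_induct)
qed

lemma alg_power_4_eq_0I:
  assumes "\<And>x y z w. ((x \<bullet> y) \<bullet> z) \<bullet> w = 0"
  shows "alg_power 4 = {0}"
  unfolding alg_power_4 span_prod_eq_0_iff
proof (intro ballI)
  fix a w assume "a \<in> span_prod (span_prod UNIV UNIV) UNIV"
  then show "a \<bullet> w = 0"
  proof (rule span_prod_induct)
    fix b z assume "b \<in> span_prod UNIV UNIV"
    then show "(b \<bullet> z) \<bullet> w = 0"
      \<comment> \<open>The inner induction is applied to the linear map sending \<open>b\<close> to
        \<open>(b \<bullet> z) \<bullet> w\<close>.\<close>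
      using assms Vector_Spaces.linear_compose[OF linear_left linear_left, unfolded o_def]
      by (rule span_prod_induct)
  qed (rule linear_left)
qed

lemma metabelianI:
  assumes "\<And>x y z w. (x \<bullet> y) \<bullet> (z \<bullet> w) = 0"
  shows metabelian
proof -
  \<comment> \<open>By bilinearity, \<open>a\<close> is reduced to a product with \<open>b\<close>
    fixed, and then \<open>b\<close> likewise.\<close>
  have "a \<bullet> b = 0" if a: "a \<in> span_prod UNIV UNIV" and b: "b \<in> span_prod UNIV UNIV" for a b
    using a
  proof (rule span_prod_induct)
    fix x y
    show "(x \<bullet> y) \<bullet> b = 0"
      using b assms linear_right by (rule span_prod_induct)
  qed (rule linear_left)
  then show ?thesis
    by (simp add: metabelian_def numeral_2_eq_2 span_prod_eq_0_iff)
qed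

end

context anticommutative_algebra
begin

lemma anticommute: "x \<bullet> y = - (y \<bullet> x)"
proof -
  have "(x + y) \<bullet> (x + y) = x \<bullet> y + y \<bullet> x"
    unfolding mult_add_left mult_add_right by (simp add: square_zero)
  then show ?thesis
    by (simp add: square_zero eq_neg_iff_add_eq_0)
qed

end

context cb_algebra
begin

lemma triple_swap12: "(y \<bullet> x) \<bullet> z = - ((x \<bullet> y) \<bullet> z)"
  by (simp only: anticommute[of y x] mult_minus_left)

lemma triple_swap13: "(z \<bullet> y) \<bullet> x = - ((x \<bullet> y) \<bullet> z)"
proof -
  \<comment> \<open>Each equation is the CB condition for an element paired with itself. Expanding
    the first and cancelling the other two leaves the mixed terms.\<close>
  have "((x + z) \<bullet> y) \<bullet> (x + z) = 0" "(x \<bullet> y) \<bullet> x = 0" "(z \<bullet> y) \<bullet> z = 0"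
    by (intro cb square_zero)+
  then show ?thesis
    by (simp add: mult_add_left mult_add_right eq_neg_iff_add_eq_0 add.commute)
qed

text \<open>The transposition (2 3) is the product (1 3)(1 2)(1 3), so three signs appear.\<close>

lemma triple_swap23: "(x \<bullet> z) \<bullet> y = - ((x \<bullet> y) \<bullet> z)"
  by (simp only: triple_swap13[of x z y] triple_swap12[of y z x] triple_swap13[of z y x] minus_minus)

lemma triple_cycle: "(y \<bullet> z) \<bullet> x = (x \<bullet> y) \<bullet> z"
  by (simp only: triple_swap12[of y z x] triple_swap13[of z y x] minus_minus)

text \<open>This is the cyclic rule with \<open>x \<bullet> y\<close> as a single entry; it links
  the products in the fourth power to those in the second derived power.\<close>

lemma quadruple_eq: "((x \<bullet> y) \<bullet> z) \<bullet> w = (z \<bullet> w) \<bullet> (x \<bullet> y)"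
  by (rule triple_cycle[symmetric])

lemma quadruple_add_self: "((x \<bullet> y) \<bullet> z) \<bullet> w + ((x \<bullet> y) \<bullet> z) \<bullet> w = 0"
proof -
  \<comment> \<open>The pairs are exchanged by a 3-cycle of the first three entries and two adjacent
    transpositions, whose signs cancel.\<close>
  have "((z \<bullet> w) \<bullet> x) \<bullet> y = ((x \<bullet> z) \<bullet> w) \<bullet> y"
    by (simp only: triple_cycle[of z w x])
  also have "\<dots> = - (((x \<bullet> z) \<bullet> y) \<bullet> w)"
    by (rule triple_swap23)
  also have "\<dots> = ((x \<bullet> y) \<bullet> z) \<bullet> w"
    by (simp add: triple_swap23[of x z y] mult_minus_left)
  finally have "(x \<bullet> y) \<bullet> (z \<bullet> w) = (z \<bullet> w) \<bullet> (x \<bullet> y)"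
    by (simp add: quadruple_eq)
  then have "(z \<bullet> w) \<bullet> (x \<bullet> y) = - ((z \<bullet> w) \<bullet> (x \<bullet> y))"
    using anticommute[of "x \<bullet> y" "z \<bullet> w"] by simp
  then show ?thesis
    by (simp only: quadruple_eq eq_neg_iff_add_eq_0)
qed

lemma quadruple_eq_0:
  assumes "CHAR('a) \<noteq> 2"
  shows "((x \<bullet> y) \<bullet> z) \<bullet> w = 0"
  using quadruple_add_self assms by (rule double_eq_0_imp)

text \<open>The three Jacobi terms are cyclic rotations of one triple product, hence equal.\<close>

lemma triple_eq_0_of_lie:
  assumes "lie_algebra scale mult" and "CHAR('a) \<noteq> 3"
  shows "(x \<bullet> y) \<bullet> z = 0"
proof (rule triple_eq_0_imp)
  show "(x \<bullet> y) \<bullet> z + (x \<bullet> y) \<bullet> z + (x \<bullet> y) \<bullet> z = 0"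
    using lie_algebra.jacobi[OF assms(1), of x y z]
    by (simp only: triple_cycle[of y z x] triple_cycle[of z x y])
qed fact

lemma triple_eq_0_of_assoc:
  assumes "assoc_algebra scale mult" and "CHAR('a) \<noteq> 2"
  shows "(x \<bullet> y) \<bullet> z = 0"
proof (rule double_eq_0_imp)
  \<comment> \<open>Reassociate to \<open>x \<bullet> (y \<bullet> z)\<close>, anticommute to
    \<open>- ((y \<bullet> z) \<bullet> x)\<close>, then rotate back.\<close>
  have "(x \<bullet> y) \<bullet> z = - ((x \<bullet> y) \<bullet> z)"
    using assoc_algebra.assoc[OF assms(1), of x y z] anticommute[of x "y \<bullet> z"] triple_cycle[of y z x]
    by simp
  then show "(x \<bullet> y) \<bullet> z + (x \<bullet> y) \<bullet> z = 0"
    by (simp only: eq_neg_iff_add_eq_0)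
qed fact

end

text \<open>The word "Moreover" makes (b) a continuation of (a), so \<open>metabelian\<close> is
  claimed for characteristic different from two.\<close>

theorem theorem4p1:
  fixes scale :: "'f::field \<Rightarrow> 'a::ab_group_add \<Rightarrow> 'a"
    and mult :: "'a \<Rightarrow> 'a \<Rightarrow> 'a"
  assumes "\<exists>Basis. finite_dimensional_vector_space scale Basis"
    and "cb_algebra scale mult"
  shows
    "(CHAR('f) \<noteq> 2 \<longrightarrow>
        nonassoc_algebra.alg_power scale mult 4 = {0} \<and>
        nonassoc_algebra.metabelian scale mult) \<and>
     (lie_algebra scale mult \<and> CHAR('f) \<noteq> 3 \<longrightarrow>
        nonassoc_algebra.alg_power scale mult 3 = {0}) \<and>
     (assoc_algebra scale mult \<and> CHAR('f) \<noteq> 2 \<longrightarrow>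
        nonassoc_algebra.alg_power scale mult 3 = {0})"
proof -
  interpret cb_algebra scale mult by fact
  show ?thesis
  proof (intro conjI impI; (elim conjE)?)
    assume "CHAR('f) \<noteq> 2"
    note zero = quadruple_eq_0[OF this]
    show "alg_power 4 = {0}"
      using zero by (rule alg_power_4_eq_0I)
    show metabelian
      \<comment> \<open>Read backwards, \<open>quadruple_eq\<close> turns
        \<open>(x \<bullet> y) \<bullet> (z \<bullet> w)\<close> into
        \<open>((z \<bullet> w) \<bullet> x) \<bullet> y\<close>, which vanishes by
        \<open>zero\<close>.\<close>
      using zero by (intro metabelianI) (simp flip: quadruple_eq)
  next
    assume "lie_algebra scale mult" "CHAR('f) \<noteq> 3"
    then show "alg_power 3 = {0}"
      by (intro alg_power_3_eq_0I triple_eq_0_of_lie)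
  next
    assume "assoc_algebra scale mult" "CHAR('f) \<noteq> 2"
    then show "alg_power 3 = {0}"
      by (intro alg_power_3_eq_0I triple_eq_0_of_assoc)
  qed
qed

end
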